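(* Let $\Lambda\leq\omega_2$ be a limit ordinal and let $\mathfrak F=(\phi_\eta)_{\eta<\Lambda}$ be a sequence of normal functions of first class satisfying properties (1)–(4) described in the context. Then $\Lambda$ is a limit ordinal of the third number class, i.e. $\Omega\leq\Lambda<\omega_2$.
   Context: $\Omega=\omega_1$, $\omega_2$ is the second uncountable initial ordinal. A normal function of first class is a strictly increasing function $\phi$ from $\{x:1\leq x<\Omega\}$ to itself which is continuous: $\phi(x)=\sup_{1\leq x'<x}\phi(x')$ for limit $x<\Omega$. $V\phi$ is its range; the derivative $\phi'$ is the normal function of first class enumerating increasingly the fixed points of $\phi$. A limit ordinal $\eta<\omega_2$ is "of the second kind" if it has cofinality $\omega$ and "of the third kind" if it has cofinality $\Omega$. For ordinals $\alpha<\beta<\Lambda$, write $\alpha\to\beta$ if $V\phi_\zeta\subseteq V\phi_\alpha$ for all $\zeta$ with $\alpha<\zeta\leq\beta$. Properties of $\mathfrak F$ (for all $\eta<\Lambda$): (1a) $\phi_0(x)=\omega^x$. (1b) If $\eta=\eta'+1$ then $\phi_\eta=\phi'_{\eta'}$. (1c) If $\eta$ is of the second kind, $\eta$ is assigned a countable limit ordinal $\tau_\eta$ and a strictly increasing sequence $(\eta_x)_{x<\tau_\eta}$ with supremum $\eta$, and $V\phi_\eta=\bigcap_{x<\tau_\eta}V\phi_{\eta_x}$. (1d) If $\eta$ is of the third kind, $\eta$ is assigned a strictly increasing sequence $(\eta_x)_{x<\Omega}$ with supremum $\eta$ (set $\tau_\eta=\Omega$), and $\phi_\eta(x)=\phi_{\eta_x}(1)$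 for $1\leq x<\Omega$. (2) For every limit $\eta<\Lambda$ with assigned sequence $(\eta_x)_{x<\tau_\eta}$ and all $x$ with $1\leq x<\tau_\eta$: (a) if $x$ is a limit ordinal, then the sequence assigned to $\eta_x$ is $(\eta_{x'})_{x'<x}$; (b) $\eta_x+1\to\eta_{x+1}$. (3) If $\eta<\Lambda$ is of the second kind and $\phi_\eta(1)=\tau_\eta$, then there is an ordinal $\tilde\eta$ of the third kind with $\eta<\tilde\eta<\Lambda$ whose assigned sequence $(\tilde\eta_x)_{x<\Omega}$ satisfies $\tilde\eta_x=\eta_x$ for $x<\tau_\eta$ and $\tilde\eta_{\tau_\eta}=\eta$. (4) If $(\eta_\nu)_{\nu<\lambda}$ is a sequence of ordinals $<\Lambda$ whose length $\lambda$ is a limit ordinal and with $\sup_{\nu<\lambda}\eta_\nu=\Lambda$, then $\bigcap_{\nu<\lambda}V\phi_{\eta_\nu}=\emptyset$. *)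

theory Defs
  imports "HOL-Library.Countable_Set"
begin

unbundle cardinal_syntax

text \<open>
  The ordinals are the elements of a concrete well-ordered type whose order type is
  the initial ordinal \<open>\<omega>\<^sub>3\<close>. It contains \<open>\<omega>\<^sub>2\<close> and is closed under suprema of families
  indexed by any of its elements.
\<close>

abbreviation aleph3 :: "nat set set set rel" where
  "aleph3 \<equiv> cardSuc (cardSuc (cardSuc natLeq))"

lemma Card_order_alephs:
  "Card_order natLeq" "Card_order (cardSuc natLeq)"
  "Card_order (cardSuc (cardSuc natLeq))" "Card_order aleph3"
  by (auto intro!: cardSuc_Card_order natLeq_Card_order)

lemma infinite_Field_alephs:
  "infinite (Field natLeq)" "infinite (Field (cardSuc natLeq))"
  "infinite (Field (cardSuc (cardSuc natLeq)))" "infinite (Field aleph3)"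
proof -
  show i0: "infinite (Field natLeq)"
    by (simp add: Field_natLeq)
  show i1: "infinite (Field (cardSuc natLeq))"
    using i0 cardSuc_finite[OF Card_order_alephs(1)] by simp
  show i2: "infinite (Field (cardSuc (cardSuc natLeq)))"
    using i1 cardSuc_finite[OF Card_order_alephs(2)] by simp
  show "infinite (Field aleph3)"
    using i2 cardSuc_finite[OF Card_order_alephs(3)] by simp
qed

lemma Well_order_aleph3: "Well_order aleph3"
  using Card_order_alephs(4) unfolding card_order_on_def by blast

typedef ordinal = "Field aleph3"
  using infinite_Field_alephs(4) by (metis finite.emptyI ex_in_conv)

instantiation ordinal :: linorder
begin

definition less_eq_ordinal :: "ordinal \<Rightarrow> ordinal \<Rightarrow> bool" where
  "(x::ordinal) \<le> y \<longleftrightarrow> (Rep_ordinal x, Rep_ordinal y) \<in> aleph3"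

definition less_ordinal :: "ordinal \<Rightarrow> ordinal \<Rightarrow> bool" where
  "(x::ordinal) < y \<longleftrightarrow> x \<le> y \<and> x \<noteq> y"

instance
proof
  have lin: "Linear_order aleph3"
    using Well_order_aleph3 unfolding well_order_on_def by blast
  have refl: "Refl aleph3" and tr: "trans aleph3" and anti: "antisym aleph3"
    and tot: "Total aleph3"
    using lin unfolding linear_order_on_def partial_order_on_def preorder_on_def by blast+
  fix x y z :: ordinal
  show r: "x \<le> x"
    using refl Rep_ordinal[of x] unfolding less_eq_ordinal_def refl_on_def by blast
  show "x \<le> y \<Longrightarrow> y \<le> z \<Longrightarrow> x \<le> z"
    using tr unfolding less_eq_ordinal_def trans_def by blast
  show as: "x \<le> y \<Longrightarrow> y \<le> x \<Longrightarrow> x = y"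
    using anti unfolding less_eq_ordinal_def antisym_def by (metis Rep_ordinal_inject)
  show "x < y \<longleftrightarrow> x \<le> y \<and> \<not> y \<le> x"
    unfolding less_ordinal_def using as r by blast
  show "x \<le> y \<or> y \<le> x"
    using tot r Rep_ordinal[of x] Rep_ordinal[of y]
    unfolding less_eq_ordinal_def total_on_def by (metis Rep_ordinal_inject)
qed

end

instance ordinal :: wellorder
proof
  fix P :: "ordinal \<Rightarrow> bool" and a
  assume step: "\<And>x. (\<And>y. y < x \<Longrightarrow> P y) \<Longrightarrow> P x"
  have "wf (aleph3 - Id)"
    using Well_order_aleph3 unfolding well_order_on_def by blast
  then have "wf (inv_image (aleph3 - Id) Rep_ordinal)"
    by (rule wf_inv_image)
  then show "P a"
  proof (induction a rule: wf_induct_rule)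
    case (less x)
    show ?case
      by (rule step, rule less)
        (auto simp: inv_image_def less_ordinal_def less_eq_ordinal_def Rep_ordinal_inject)
  qed
qed

lemma Rep_image_lessThan:
  "Rep_ordinal ` {..<x} = underS aleph3 (Rep_ordinal x)"
proof (intro equalityI subsetI)
  fix u assume "u \<in> Rep_ordinal ` {..<x}"
  then show "u \<in> underS aleph3 (Rep_ordinal x)"
    by (auto simp: underS_def less_ordinal_def less_eq_ordinal_def Rep_ordinal_inject)
next
  fix u assume u: "u \<in> underS aleph3 (Rep_ordinal x)"
  then have "u \<in> Field aleph3"
    by (auto simp: underS_def Field_def)
  then obtain y where "u = Rep_ordinal y"
    by (metis Rep_ordinal_cases)
  with u show "u \<in> Rep_ordinal ` {..<x}"
    by (auto simp: underS_def less_ordinal_def less_eq_ordinal_def Rep_ordinal_inject)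
qed

lemma card_of_lessThan_ordinal:
  fixes x :: ordinal
  shows "|{..<x}| =o |underS aleph3 (Rep_ordinal x)|"
proof -
  have "bij_betw Rep_ordinal {..<x} (underS aleph3 (Rep_ordinal x))"
    by (simp add: bij_betw_def Rep_image_lessThan inj_on_def Rep_ordinal_inject)
  then show ?thesis
    using card_of_ordIso by blast
qed

lemma greater_ordinal_ex: "\<exists>z. (x::ordinal) < z"
proof -
  obtain b where b: "b \<in> Field aleph3" "Rep_ordinal x \<noteq> b" "(Rep_ordinal x, b) \<in> aleph3"
    using infinite_Card_order_limit[OF Card_order_alephs(4) infinite_Field_alephs(4) Rep_ordinal]
    by blast
  then obtain z where "b = Rep_ordinal z"
    by (metis Rep_ordinal_cases)
  with b have "x < z"
    by (auto simp: less_ordinal_def less_eq_ordinal_def)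
  then show ?thesis ..
qed

lemma bounded_ordinal_set:
  fixes A :: "ordinal set"
  assumes "|A| \<le>o cardSuc (cardSuc natLeq)"
  shows "\<exists>z. \<forall>x\<in>A. x < z"
proof -
  let ?r = "cardSuc (cardSuc natLeq)"
  let ?K = "Rep_ordinal ` A"
  have lt: "|?K| <o aleph3"
    by (rule ordLeq_ordLess_trans[OF ordLeq_transitive[OF card_of_image assms]
          cardSuc_greater[OF Card_order_alephs(3)]])
  have "regularCard aleph3"
    using infinite_cardSuc_regularCard infinite_Field_alephs(3) Card_order_alephs(3) by blast
  moreover have "?K \<subseteq> Field aleph3"
    using Rep_ordinal by blast
  ultimately have "\<not> cofinal ?K aleph3"
    using lt not_ordLess_ordIso unfolding regularCard_def by blast
  then obtain a where a: "a \<in> Field aleph3"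
    and na: "\<And>b. b \<in> ?K \<Longrightarrow> \<not> (a \<noteq> b \<and> (a, b) \<in> aleph3)"
    unfolding cofinal_def by blast
  obtain w where w: "a = Rep_ordinal w"
    using a by (metis Rep_ordinal_cases)
  have le: "x \<le> w" if "x \<in> A" for x
    using na[of "Rep_ordinal x"] that w
    by (metis imageI less_eq_ordinal_def linorder_le_cases Rep_ordinal_inject)
  obtain z where "w < z"
    using greater_ordinal_ex by blast
  then show ?thesis
    using le by (meson order.strict_trans1)
qed

lemma card_of_lessThan_ordinal_le:
  fixes x :: ordinal
  shows "|{..<x}| \<le>o cardSuc (cardSuc natLeq)"
proof -
  have "|underS aleph3 (Rep_ordinal x)| <o aleph3"
    using card_of_underS[OF Card_order_alephs(4) Rep_ordinal] .
  then have "|{..<x}| <o aleph3"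
    by (rule ordIso_ordLess_trans[OF card_of_lessThan_ordinal])
  then show ?thesis
    by (simp only: cardSuc_ordLeq_ordLess[OF Card_order_alephs(3) card_of_Card_order])
qed

lemma bounded_ordinal_family:
  fixes f :: "ordinal \<Rightarrow> ordinal"
  shows "\<exists>z. \<forall>x<a. f x < z"
proof -
  have "|f ` {..<a}| \<le>o cardSuc (cardSuc natLeq)"
    by (rule ordLeq_transitive[OF card_of_image card_of_lessThan_ordinal_le])
  then show ?thesis
    using bounded_ordinal_set by fastforce
qed

instantiation ordinal :: conditionally_complete_linorder
begin

definition inf_ordinal :: "ordinal \<Rightarrow> ordinal \<Rightarrow> ordinal" where
  "inf_ordinal = min"

definition sup_ordinal :: "ordinal \<Rightarrow> ordinal \<Rightarrow> ordinal" where
  "sup_ordinal = max"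

definition Inf_ordinal :: "ordinal set \<Rightarrow> ordinal" where
  "Inf (A::ordinal set) = (LEAST x. x \<in> A)"

definition Sup_ordinal :: "ordinal set \<Rightarrow> ordinal" where
  "Sup (A::ordinal set) = (LEAST z. \<forall>x\<in>A. x \<le> z)"

instance
proof
  fix x z :: ordinal and X :: "ordinal set"
  show "x \<in> X \<Longrightarrow> bdd_below X \<Longrightarrow> Inf X \<le> x"
    by (simp add: Inf_ordinal_def Least_le)
  show "X \<noteq> {} \<Longrightarrow> (\<And>x. x \<in> X \<Longrightarrow> z \<le> x) \<Longrightarrow> z \<le> Inf X"
    unfolding Inf_ordinal_def by (metis LeastI ex_in_conv)
  show "Sup X \<le> z" if "X \<noteq> {}" "\<And>x. x \<in> X \<Longrightarrow> x \<le> z"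
    unfolding Sup_ordinal_def using that by (auto intro: Least_le)
  assume x: "x \<in> X" and "bdd_above X"
  then obtain b where "\<forall>x\<in>X. x \<le> b"
    unfolding bdd_above_def by blast
  then have "\<forall>x\<in>X. x \<le> Sup X"
    unfolding Sup_ordinal_def by (rule LeastI)
  with x show "x \<le> Sup X" by blast
qed (auto simp: inf_ordinal_def sup_ordinal_def)

end

definition osuc :: "ordinal \<Rightarrow> ordinal" where
  "osuc x = (LEAST y. x < y)"

instantiation ordinal :: "{zero, one}"
begin

definition zero_ordinal :: ordinal where
  "(0::ordinal) = (LEAST x. True)"

definition one_ordinal :: ordinal where
  "(1::ordinal) = osuc 0"

instance ..

end

lemma zero_le_ordinal [simp]: "0 \<le> (x::ordinal)"
  by (simp add: zero_ordinal_def Least_le)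

lemma less_osuc [simp]: "x < osuc x"
  unfolding osuc_def using greater_ordinal_ex by (rule LeastI_ex)

lemma osuc_le_iff: "osuc x \<le> y \<longleftrightarrow> x < y"
  by (metis Least_le less_osuc order.strict_trans2 osuc_def)

lemma less_osuc_iff: "x < osuc y \<longleftrightarrow> x \<le> y"
  by (metis linorder_not_le osuc_le_iff)

lemma osuc_inject [simp]: "osuc x = osuc y \<longleftrightarrow> x = y"
  by (metis less_osuc less_osuc_iff order_antisym)

definition limit_ordinal :: "ordinal \<Rightarrow> bool" where
  "limit_ordinal x \<longleftrightarrow> x \<noteq> 0 \<and> (\<forall>y<x. osuc y < x)"

lemma osuc_not_limit [simp]: "\<not> limit_ordinal (osuc x)"
  unfolding limit_ordinal_def using less_osuc by blast

lemma osuc_ne_zero [simp]: "osuc x \<noteq> 0"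
  by (metis less_osuc linorder_not_le zero_le_ordinal)

lemma ordinal_cases [case_names zero suc limit]:
  obtains "x = 0" | y where "x = osuc y" | "limit_ordinal x"
  by (metis limit_ordinal_def order_le_less osuc_le_iff)


section \<open>Arithmetic up to powers of \<open>\<omega>\<close>\<close>

text \<open>Transfinite recursion with start value \<open>z\<close>, successor step \<open>s\<close> and suprema at limits.\<close>

function ordinal_rec :: "ordinal \<Rightarrow> (ordinal \<Rightarrow> ordinal) \<Rightarrow> ordinal \<Rightarrow> ordinal" where
  "ordinal_rec z s x =
     (if x = 0 then z
      else if limit_ordinal x then (SUP y\<in>{..<x}. ordinal_rec z s y)
      else s (ordinal_rec z s (THE y. x = osuc y)))"
  by pat_completeness auto
termination
proof (relation "inv_image {(x, y). x < y} (\<lambda>(z, s, x). x)")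
  show "wf (inv_image {(x::ordinal, y). x < y} (\<lambda>(z::ordinal, s::ordinal \<Rightarrow> ordinal, x). x))"
    by (intro wf_inv_image wf)
next
  fix z x :: ordinal and s
  assume "x \<noteq> 0" "\<not> limit_ordinal x"
  then obtain y where "x = osuc y"
    by (cases x rule: ordinal_cases) auto
  then show "((z, s, THE y. x = osuc y), z, s, x)
    \<in> inv_image {(x, y). x < y} (\<lambda>(z::ordinal, s::ordinal \<Rightarrow> ordinal, x). x)"
    by auto
qed auto

declare ordinal_rec.simps [simp del]

lemma ordinal_rec_zero: "ordinal_rec z s 0 = z"
  by (simp add: ordinal_rec.simps)

lemma ordinal_rec_osuc: "ordinal_rec z s (osuc x) = s (ordinal_rec z s x)"
  by (subst ordinal_rec.simps) simp

lemma ordinal_rec_limit: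
  "limit_ordinal x \<Longrightarrow> ordinal_rec z s x = (SUP y\<in>{..<x}. ordinal_rec z s y)"
  by (subst ordinal_rec.simps) (auto simp: limit_ordinal_def)

definition ordinal_add :: "ordinal \<Rightarrow> ordinal \<Rightarrow> ordinal" where
  "ordinal_add a = ordinal_rec a osuc"

definition ordinal_mult :: "ordinal \<Rightarrow> ordinal \<Rightarrow> ordinal" where
  "ordinal_mult a = ordinal_rec 0 (\<lambda>u. ordinal_add u a)"

definition omega :: ordinal where
  "omega = (LEAST x. limit_ordinal x)"

definition omega_power :: "ordinal \<Rightarrow> ordinal" where
  "omega_power = ordinal_rec 1 (\<lambda>u. ordinal_mult u omega)"


section \<open>Initial ordinals and cofinality\<close>

definition omega1 :: ordinal where
  "omega1 = (LEAST x. uncountable {..<x})"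

definition omega2 :: ordinal where
  "omega2 = (LEAST x. |{..<omega1}| <o |{..<x}| )"

lemma ordinal_of_card_ex:
  assumes "Well_order r" "r <o aleph3"
  shows "\<exists>x::ordinal. |{..<x}| =o |Field r|"
proof -
  obtain a where a: "a \<in> Field aleph3" and iso: "r =o Restr aleph3 (underS aleph3 a)"
    using ordLess_iff_ordIso_Restr[OF Well_order_aleph3 assms(1)] assms(2) by blast
  obtain x where x: "a = Rep_ordinal x"
    using a by (metis Rep_ordinal_cases)
  have "Field (Restr aleph3 (underS aleph3 a)) = underS aleph3 a"
    using Field_Restr_ofilter[OF Well_order_aleph3] Well_order_aleph3
      wo_rel.underS_ofilter[of aleph3 a] by (simp add: wo_rel_def)
  then have "|Field r| =o |underS aleph3 (Rep_ordinal x)|"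
    using card_of_cong[OF iso] x by simp
  then have "|{..<x}| =o |Field r|"
    by (rule ordIso_transitive[OF card_of_lessThan_ordinal ordIso_symmetric])
  then show ?thesis ..
qed

lemma countable_iff_natLeq: "countable A \<longleftrightarrow> |A| \<le>o natLeq"
proof -
  have "countable A \<longleftrightarrow> |A| \<le>o |UNIV::nat set|"
    unfolding card_of_ordLeq[symmetric] countable_def by simp
  also have "\<dots> \<longleftrightarrow> |A| \<le>o natLeq"
    using card_of_nat ordIso_symmetric[OF card_of_nat] ordLeq_ordIso_trans by blast
  finally show ?thesis .
qed

lemma omega1_ex: "\<exists>x::ordinal. |{..<x}| =o cardSuc natLeq"
proof -
  have "cardSuc natLeq <o aleph3"
    by (rule ordLess_transitive[OF cardSuc_greater[OF Card_order_alephs(2)]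
          cardSuc_greater[OF Card_order_alephs(3)]])
  moreover have "Well_order (cardSuc natLeq)"
    using Card_order_alephs(2) unfolding card_order_on_def by blast
  ultimately show ?thesis
    using ordinal_of_card_ex card_of_Field_ordIso[OF Card_order_alephs(2)] ordIso_transitive
    by blast
qed

lemma omega2_ex: "\<exists>x::ordinal. |{..<x}| =o cardSuc (cardSuc natLeq)"
proof -
  have "cardSuc (cardSuc natLeq) <o aleph3"
    by (rule cardSuc_greater[OF Card_order_alephs(3)])
  moreover have "Well_order (cardSuc (cardSuc natLeq))"
    using Card_order_alephs(3) unfolding card_order_on_def by blast
  ultimately show ?thesis
    using ordinal_of_card_ex card_of_Field_ordIso[OF Card_order_alephs(3)] ordIso_transitive
    by blast
qed

lemma uncountable_iff_aleph1: "uncountable A \<longleftrightarrow> cardSuc natLeq \<le>o |A|"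
  unfolding countable_iff_natLeq
    not_ordLeq_iff_ordLess[OF natLeq_Well_order card_of_Well_order]
  by (rule cardSuc_ordLess_ordLeq[OF Card_order_alephs(1) card_of_Card_order])

lemma uncountable_omega1: "uncountable {..<omega1}"
proof -
  obtain x :: ordinal where x: "|{..<x}| =o cardSuc natLeq"
    using omega1_ex by blast
  have "uncountable {..<x}"
    unfolding uncountable_iff_aleph1 by (rule ordIso_imp_ordLeq[OF ordIso_symmetric[OF x]])
  then show ?thesis
    unfolding omega1_def by (rule LeastI)
qed

lemma countable_below_omega1: "x < omega1 \<Longrightarrow> countable {..<x}"
  unfolding omega1_def using not_less_Least by blast

lemma card_omega1: "|{..<omega1}| =o cardSuc natLeq"
proof -
  obtain x :: ordinal where x: "|{..<x}| =o cardSuc natLeq"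
    using omega1_ex by blast
  then have "uncountable {..<x}"
    unfolding uncountable_iff_aleph1 by (rule ordIso_imp_ordLeq[OF ordIso_symmetric])
  then have "omega1 \<le> x"
    unfolding omega1_def by (rule Least_le)
  then have "|{..<omega1}| \<le>o |{..<x}|"
    by (intro card_of_mono1) auto
  then have "|{..<omega1}| \<le>o cardSuc natLeq"
    by (rule ordLeq_ordIso_trans[OF _ x])
  then show ?thesis
    using uncountable_omega1 unfolding uncountable_iff_aleph1 ordIso_iff_ordLeq by (rule conjI)
qed

lemma card_omega2_greater: "|{..<omega1}| <o |{..<omega2}|"
proof -
  obtain x :: ordinal where x: "|{..<x}| =o cardSuc (cardSuc natLeq)"
    using omega2_ex by blast
  have "|{..<omega1}| <o |{..<x}|"
    by (rule ordIso_ordLess_trans[OF card_omega1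
          ordLess_ordIso_trans[OF cardSuc_greater[OF Card_order_alephs(2)] ordIso_symmetric[OF x]]])
  then show ?thesis
    unfolding omega2_def by (rule LeastI)
qed

lemma limit_ordinal_ex: "\<exists>x. limit_ordinal x"
proof -
  obtain z where z: "\<forall>n. ((osuc ^^ n) 0) < z"
  proof -
    have "|range (\<lambda>n. (osuc ^^ n) 0)| \<le>o natLeq"
      by (metis countable_iff_natLeq countable_image countableI_type)
    moreover have "natLeq \<le>o cardSuc (cardSuc natLeq)"
      by (rule ordLeq_transitive[OF cardSuc_ordLeq[OF Card_order_alephs(1)]
            cardSuc_ordLeq[OF Card_order_alephs(2)]])
    ultimately have "|range (\<lambda>n. (osuc ^^ n) 0)| \<le>o cardSuc (cardSuc natLeq)"
      by (rule ordLeq_transitive)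
    from bounded_ordinal_set[OF this] show ?thesis
      using that by blast
  qed
  define w where "w = (LEAST z. \<forall>n. ((osuc ^^ n) 0) < z)"
  have w: "(osuc ^^ n) 0 < w" for n
    unfolding w_def using LeastI[of "\<lambda>z. \<forall>n. ((osuc ^^ n) 0) < z", OF z] by blast
  have "osuc y < w" if yw: "y < w" for y
  proof -
    obtain n where "y \<le> (osuc ^^ n) 0"
      using not_less_Least[OF yw[unfolded w_def]] by (metis linorder_not_less)
    then have "osuc y \<le> (osuc ^^ Suc n) 0"
      by (simp add: osuc_le_iff less_osuc_iff)
    then show ?thesis
      using w order.strict_trans1 by blast
  qed
  moreover have "w \<noteq> 0"
    using w[of 0] by auto
  ultimately show ?thesis
    unfolding limit_ordinal_def by blast
qed

lemma limit_omega: "limit_ordinal omega"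
  unfolding omega_def using limit_ordinal_ex by (rule LeastI_ex)

unbundle no cardinal_syntax

definition cofinality :: "ordinal \<Rightarrow> ordinal" where
  "cofinality x =
     (LEAST a. \<exists>f. (\<forall>u<a. f u < x) \<and> (\<forall>y<x. \<exists>u<a. y \<le> f u))"

definition second_kind :: "ordinal \<Rightarrow> bool" where
  "second_kind x \<longleftrightarrow> limit_ordinal x \<and> x < omega2 \<and> cofinality x = omega"

definition third_kind :: "ordinal \<Rightarrow> bool" where
  "third_kind x \<longleftrightarrow> limit_ordinal x \<and> x < omega2 \<and> cofinality x = omega1"


section \<open>Normal functions of first class\<close>

text \<open>
  Normal functions are total functions on \<^typ>\<open>ordinal\<close>; only their values on
  \<open>{1..<omega1}\<close> are ever referred to.
\<close>

definition normal_fun :: "(ordinal \<Rightarrow> ordinal) \<Rightarrow> bool" where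
  "normal_fun f \<longleftrightarrow>
     f ` {1..<omega1} \<subseteq> {1..<omega1} \<and>
     strict_mono_on {1..<omega1} f \<and>
     (\<forall>x<omega1. limit_ordinal x \<longrightarrow> f x = (SUP y\<in>{1..<x}. f y))"

definition V :: "(ordinal \<Rightarrow> ordinal) \<Rightarrow> ordinal set" where
  "V f = f ` {1..<omega1}"

definition is_derivative :: "(ordinal \<Rightarrow> ordinal) \<Rightarrow> (ordinal \<Rightarrow> ordinal) \<Rightarrow> bool" where
  "is_derivative f g \<longleftrightarrow> normal_fun g \<and> V g = {x \<in> {1..<omega1}. f x = x}"

text \<open>
  The relation is meant for \<open>\<alpha> < \<beta>\<close>; for \<open>\<alpha> = \<beta>\<close>, which occurs when consecutive members of
  an assigned sequence are consecutive ordinals, it is vacuously true.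
\<close>

definition arrow :: "(ordinal \<Rightarrow> ordinal \<Rightarrow> ordinal) \<Rightarrow> ordinal \<Rightarrow> ordinal \<Rightarrow> bool" where
  "arrow \<phi> \<alpha> \<beta> \<longleftrightarrow> (\<forall>\<zeta>. \<alpha> < \<zeta> \<and> \<zeta> \<le> \<beta> \<longrightarrow> V (\<phi> \<zeta>) \<subseteq> V (\<phi> \<alpha>))"

end

theory Submission
  imports Defs
begin

text \<open>
  Countably many normal functions of first class have a common fixed point, so the intersection
  in property (4) is nonempty when \<open>\<Lambda>\<close> is countable. If \<open>\<Lambda> = \<omega>\<^sub>2\<close>, the values
  \<open>\<phi>\<^sub>\<eta>(1)\<close> lie below \<open>\<omega>\<^sub>1\<close>, so by the pigeonhole principle one value \<open>\<gamma>\<close> is attained for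
  cofinally many \<open>\<eta>\<close>, and \<open>\<gamma>\<close> lies in the intersection along these \<open>\<eta>\<close>.
\<close>

lemma one_less_omega1: "1 < omega1"
proof (rule ccontr)
  assume "\<not> 1 < omega1"
  then have "{..<omega1} \<subseteq> {0}"
    by (metis less_osuc_iff lessThan_iff not_less one_ordinal_def order_antisym order.strict_trans2
        singletonI subsetI zero_le_ordinal)
  then show False
    using uncountable_omega1 countable_finite finite_subset by blast
qed

text \<open>This is the regularity of \<open>omega1\<close> for countable sets: if \<open>A\<close>
  were unbounded, \<open>omega1\<close> would be a countable union of the countable segments
  \<open>{..a}\<close>.\<close>

lemma countable_subset_omega1_bounded:
  assumes "countable A" "A \<subseteq> {..<omega1}"
  shows "\<exists>z<omega1. \<forall>a\<in>A. a < z"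
proof (rule ccontr)
  assume "\<not> ?thesis"
  then have "{..<omega1} \<subseteq> (\<Union>a\<in>A. {..a})"
    by (force simp: not_less)
  moreover have "countable {..a}" if "a \<in> A" for a
  proof -
    have "{..a} = insert a {..<a}"
      by auto
    then show ?thesis
      using countable_below_omega1[of a] assms(2) that by auto
  qed
  then have "countable (\<Union>a\<in>A. {..a})"
    using assms(1) by blast
  ultimately show False
    using uncountable_omega1 countable_subset by blast
qed

lemma normal_fun_ge:
  assumes f: "normal_fun f" and "1 \<le> x" "x < omega1"
  shows "x \<le> f x"
  using assms(2,3)
proof (induction x rule: less_induct)
  case (less x)
  show ?case
  proof (rule ccontr)
    assume "\<not> x \<le> f x"
    then have lt: "f x < x" by simp
    have fx: "f x \<in> {1..<omega1}"
      using f less.prems unfolding normal_fun_def by (simp add: image_subset_iff)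
    \<comment> \<open>Strict monotonicity carries \<open>f x < x\<close> over to the smaller
      argument \<open>f x\<close>, where the induction hypothesis forbids it.\<close>
    then have "f (f x) < f x"
      using f less.prems lt unfolding normal_fun_def
      by (intro strict_mono_onD[of "{1..<omega1}" f]) auto
    with less.IH[OF lt] fx show False by simp
  qed
qed

text \<open>A closing-off argument: build an \<omega>-sequence in which each term exceeds all values
  of \<open>F\<close> at the previous one. Its supremum is below \<open>omega1\<close> by regularity
  and, by continuity, is fixed by every member of \<open>F\<close>.\<close>

lemma countable_common_fixed_point:
  assumes F: "countable F" and normal: "\<And>f. f \<in> F \<Longrightarrow> normal_fun f"
  shows "\<exists>x\<in>{1..<omega1}. \<forall>f\<in>F. f x = x"
proof -
  have step: "\<exists>z\<in>{1..<omega1}. x < z \<and> (\<forall>f\<in>F. f x < z)" if x: "x \<in> {1..<omega1}" for x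
  proof -
    have "insert x ((\<lambda>f. f x) ` F) \<subseteq> {..<omega1}"
      using normal x unfolding normal_fun_def by fastforce
    then obtain z where "z < omega1" "x < z" "\<forall>f\<in>F. f x < z"
      using countable_subset_omega1_bounded[of "insert x ((\<lambda>f. f x) ` F)"] F by auto
    then show ?thesis
      using x by (intro bexI[of _ z]) auto
  qed
  then obtain g where g: "\<And>x. x \<in> {1..<omega1} \<Longrightarrow>
      g x \<in> {1..<omega1} \<and> x < g x \<and> (\<forall>f\<in>F. f x < g x)"
    by metis
  define a where "a n = (g ^^ n) 1" for n
  have a: "a n \<in> {1..<omega1}" for n
    by (induction n) (use one_less_omega1 g in \<open>auto simp: a_def\<close>)
  have a_less: "a n < a (Suc n)" and a_fun: "f \<in> F \<Longrightarrow> f (a n) < a (Suc n)" for n f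
    using g[OF a[of n]] by (auto simp: a_def)
  \<comment> \<open>Since \<open>a\<close> is strictly increasing, the least strict upper bound is
    its supremum; the strict form gives \<open>a n < x\<close> at once.\<close>
  define x where "x = (LEAST z. \<forall>n. a n < z)"
  obtain b where b: "b < omega1" "\<forall>n. a n < b"
    using countable_subset_omega1_bounded[of "range a"] a by auto
  have xa: "a n < x" for n
    unfolding x_def using LeastI[of "\<lambda>z. \<forall>n. a n < z", OF b(2)] by blast
  have below_x: "\<exists>n. y < a n" if y: "y < x" for y
  proof -
    obtain n where "y \<le> a n"
      using not_less_Least[OF y[unfolded x_def]] by (auto simp: not_less)
    then have "y < a (Suc n)"
      using a_less by (rule le_less_trans)
    then show ?thesis ..
  qed
  have x: "x \<in> {1..<omega1}"
    using Least_le[of "\<lambda>z. \<forall>n. a n < z", OF b(2)] b(1) a[of 0] xa[of 0]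
    unfolding x_def[symmetric] by auto
  have "limit_ordinal x"
    unfolding limit_ordinal_def
  proof (intro conjI allI impI)
    show "x \<noteq> 0"
      using xa[of 0] zero_le_ordinal[of "a 0"] not_less by blast
    show "osuc y < x" if "y < x" for y
      using below_x[OF that] xa by (metis osuc_le_iff le_less_trans)
  qed
  have "f x = x" if f: "f \<in> F" for f
  proof (rule antisym)
    \<comment> \<open>As \<open>x\<close> is a limit, \<open>f x\<close> is the supremum of these
      values, so bounding each of them by \<open>x\<close> suffices.\<close>
    have "f y \<le> x" if y: "y \<in> {1..<x}" for y
    proof -
      obtain n where n: "y < a n"
        using below_x y by auto
      then have "f y < f (a n)"
        using normal[OF f] a[of n] y x unfolding normal_fun_def
        by (intro strict_mono_onD[of "{1..<omega1}" f]) auto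
      also have "\<dots> < a (Suc n)"
        by (rule a_fun[OF f])
      also have "\<dots> < x"
        by (rule xa)
      finally show ?thesis by simp
    qed
    moreover have "1 \<in> {1..<x}"
      using xa[of 0] by (simp add: a_def)
    ultimately have "(SUP y\<in>{1..<x}. f y) \<le> x"
      by (intro cSUP_least) auto
    then show "f x \<le> x"
      using normal[OF f] \<open>limit_ordinal x\<close> x unfolding normal_fun_def by auto
    show "x \<le> f x"
      using normal_fun_ge[OF normal[OF f]] x by auto
  qed
  then show ?thesis
    using x by blast
qed

context
  includes cardinal_syntax
begin

text \<open>If every fibre of \<open>h\<close> were bounded below \<open>omega2\<close>, these
  bounds would cover \<open>{..<omega2}\<close> by \<open>omega1\<close> many segments of
  cardinality at most that of \<open>omega1\<close>, making \<open>omega2\<close> too small.\<close>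

lemma omega2_pigeonhole:
  fixes h :: "ordinal \<Rightarrow> ordinal"
  assumes h: "\<And>\<eta>. \<eta> < omega2 \<Longrightarrow> h \<eta> < omega1"
  shows "\<exists>\<gamma> < omega1. \<forall>\<beta> < omega2. \<exists>\<eta>. \<beta> \<le> \<eta> \<and> \<eta> < omega2 \<and> h \<eta> = \<gamma>"
proof (rule ccontr)
  assume "\<not> ?thesis"
  then have "\<forall>\<gamma>\<in>{..<omega1}. \<exists>\<beta> < omega2. \<forall>\<eta>. \<eta> < omega2 \<and> h \<eta> = \<gamma> \<longrightarrow> \<eta> < \<beta>"
    by (metis lessThan_iff not_le)
  then obtain b where b: "\<And>\<gamma>. \<gamma> < omega1 \<Longrightarrow> b \<gamma> < omega2"
      "\<And>\<eta>. \<eta> < omega2 \<Longrightarrow> \<eta> < b (h \<eta>)"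
    using h by (metis lessThan_iff)
  have "|{..<b \<gamma>}| \<le>o |{..<omega1}|" if "\<gamma> < omega1" for \<gamma>
    \<comment> \<open>Minimality of \<open>omega2\<close>: no smaller ordinal has a segment of
      cardinality greater than that of \<open>{..<omega1}\<close>.\<close>
    using not_less_Least[OF b(1)[OF that, unfolded omega2_def]]
    by (simp only: not_ordLess_iff_ordLeq[OF card_of_Well_order card_of_Well_order])
  moreover have "infinite {..<omega1}"
    using uncountable_omega1 countable_finite by blast
  ultimately have "|\<Union>\<gamma>\<in>{..<omega1}. {..<b \<gamma>}| \<le>o |{..<omega1}|"
    by (intro card_of_UNION_ordLeq_infinite) (auto intro: card_of_refl ordIso_imp_ordLeq)
  moreover have "{..<omega2} \<subseteq> (\<Union>\<gamma>\<in>{..<omega1}. {..<b \<gamma>})"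
    using b(2) h by auto
  ultimately have "|{..<omega2}| \<le>o |{..<omega1}|"
    using card_of_mono1 ordLeq_transitive by blast
  with card_omega2_greater show False
    using not_ordLess_ordLeq by blast
qed

end

text \<open>Supplies the supremum condition of \<open>p4\<close> for sequences of length \<Lambda>.
  Monotonicity of \<open>e\<close> is not assumed, so arbitrarily chosen indices can be
  used.\<close>

lemma limit_SUP_eq:
  assumes "limit_ordinal \<Lambda>" and "\<And>\<nu>. \<nu> < \<Lambda> \<Longrightarrow> \<nu> \<le> e \<nu>" and "\<And>\<nu>. \<nu> < \<Lambda> \<Longrightarrow> e \<nu> < \<Lambda>"
  shows "(SUP \<nu>\<in>{..<\<Lambda>}. e \<nu>) = \<Lambda>"
proof (rule antisym)
  have "0 < \<Lambda>"
    using assms(1) by (metis limit_ordinal_def order_le_less zero_le_ordinal)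
  then show "(SUP \<nu>\<in>{..<\<Lambda>}. e \<nu>) \<le> \<Lambda>"
    using assms(3) by (intro cSUP_least) (auto simp: less_imp_le)
  have "bdd_above (e ` {..<\<Lambda>})"
    using assms(3) by (auto intro!: bdd_aboveI[of _ \<Lambda>] simp: less_imp_le)
  then have upper: "\<nu> \<le> (SUP \<nu>\<in>{..<\<Lambda>}. e \<nu>)" if "\<nu> < \<Lambda>" for \<nu>
    using assms(2)[OF that] cSUP_upper[of \<nu> "{..<\<Lambda>}" e] that by simp
  show "\<Lambda> \<le> (SUP \<nu>\<in>{..<\<Lambda>}. e \<nu>)"
  proof (rule ccontr)
    assume "\<not> ?thesis"
    \<comment> \<open>The successor of a supremum below \<Lambda> is itself an admissible index, so
      it would be bounded by that supremum.\<close>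
    then have "osuc (SUP \<nu>\<in>{..<\<Lambda>}. e \<nu>) < \<Lambda>"
      using assms(1) by (simp add: limit_ordinal_def)
    from upper[OF this] show False
      by (simp add: osuc_le_iff)
  qed
qed

theorem theorem2:
  fixes \<Lambda> :: ordinal
    and \<phi> :: "ordinal \<Rightarrow> ordinal \<Rightarrow> ordinal"
    and \<tau> :: "ordinal \<Rightarrow> ordinal"
    and s :: "ordinal \<Rightarrow> ordinal \<Rightarrow> ordinal"
  assumes limit: "limit_ordinal \<Lambda>" and le: "\<Lambda> \<le> omega2"
    and normal: "\<And>\<eta>. \<eta> < \<Lambda> \<Longrightarrow> normal_fun (\<phi> \<eta>)"
    and p1a: "\<And>x. 1 \<le> x \<Longrightarrow> x < omega1 \<Longrightarrow> \<phi> 0 x = omega_power x"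
    and p1b: "\<And>\<eta>'. osuc \<eta>' < \<Lambda> \<Longrightarrow> is_derivative (\<phi> \<eta>') (\<phi> (osuc \<eta>'))"
    and p1c: "\<And>\<eta>. \<eta> < \<Lambda> \<Longrightarrow> second_kind \<eta> \<Longrightarrow>
        limit_ordinal (\<tau> \<eta>) \<and> \<tau> \<eta> < omega1 \<and>
        strict_mono_on {..<\<tau> \<eta>} (s \<eta>) \<and> (SUP x\<in>{..<\<tau> \<eta>}. s \<eta> x) = \<eta> \<and>
        V (\<phi> \<eta>) = (\<Inter>x\<in>{..<\<tau> \<eta>}. V (\<phi> (s \<eta> x)))"
    and p1d: "\<And>\<eta>. \<eta> < \<Lambda> \<Longrightarrow> third_kind \<eta> \<Longrightarrow>
        \<tau> \<eta> = omega1 \<and>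
        strict_mono_on {..<\<tau> \<eta>} (s \<eta>) \<and> (SUP x\<in>{..<\<tau> \<eta>}. s \<eta> x) = \<eta> \<and>
        (\<forall>x. 1 \<le> x \<and> x < omega1 \<longrightarrow> \<phi> \<eta> x = \<phi> (s \<eta> x) 1)"
    and p2a: "\<And>\<eta> x. \<eta> < \<Lambda> \<Longrightarrow> limit_ordinal \<eta> \<Longrightarrow> 1 \<le> x \<Longrightarrow> x < \<tau> \<eta> \<Longrightarrow> limit_ordinal x \<Longrightarrow>
        limit_ordinal (s \<eta> x) \<and> \<tau> (s \<eta> x) = x \<and> (\<forall>x'<x. s (s \<eta> x) x' = s \<eta> x')"
    and p2b: "\<And>\<eta> x. \<eta> < \<Lambda> \<Longrightarrow> limit_ordinal \<eta> \<Longrightarrow> 1 \<le> x \<Longrightarrow> x < \<tau> \<eta> \<Longrightarrow>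
        arrow \<phi> (osuc (s \<eta> x)) (s \<eta> (osuc x))"
    and p3: "\<And>\<eta>. \<eta> < \<Lambda> \<Longrightarrow> second_kind \<eta> \<Longrightarrow> \<phi> \<eta> 1 = \<tau> \<eta> \<Longrightarrow>
        \<exists>\<mu>. third_kind \<mu> \<and> \<eta> < \<mu> \<and> \<mu> < \<Lambda> \<and>
          (\<forall>x<\<tau> \<eta>. s \<mu> x = s \<eta> x) \<and> s \<mu> (\<tau> \<eta>) = \<eta>"
    and p4: "\<And>(l::ordinal) (e :: ordinal \<Rightarrow> ordinal).
        limit_ordinal l \<Longrightarrow> (\<forall>\<nu><l. e \<nu> < \<Lambda>) \<Longrightarrow> (SUP \<nu>\<in>{..<l}. e \<nu>) = \<Lambda> \<Longrightarrow>
        (\<Inter>\<nu>\<in>{..<l}. V (\<phi> (e \<nu>))) = {}"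
  shows "limit_ordinal \<Lambda> \<and> omega1 \<le> \<Lambda> \<and> \<Lambda> < omega2"
proof (intro conjI limit)
  show "omega1 \<le> \<Lambda>"
  proof (rule ccontr)
    assume "\<not> omega1 \<le> \<Lambda>"
    then have "countable (\<phi> ` {..<\<Lambda>})"
      using countable_below_omega1[of \<Lambda>] by simp
    then have "\<exists>x\<in>{1..<omega1}. \<forall>f\<in>\<phi> ` {..<\<Lambda>}. f x = x"
      by (rule countable_common_fixed_point) (use normal in auto)
    then obtain x where x: "x \<in> {1..<omega1}" "\<And>\<nu>. \<nu> < \<Lambda> \<Longrightarrow> \<phi> \<nu> x = x"
      by auto
    then have "x \<in> V (\<phi> \<nu>)" if "\<nu> < \<Lambda>" for \<nu>
      unfolding V_def using that by (metis imageI)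
    \<comment> \<open>Here \<open>p4\<close> is applied to the identity sequence, so the
      intersection runs over the whole family.\<close>
    moreover have "(\<Inter>\<nu>\<in>{..<\<Lambda>}. V (\<phi> \<nu>)) = {}"
      using limit_SUP_eq[OF limit, of "\<lambda>\<nu>. \<nu>"] by (intro p4 limit) auto
    ultimately show False by blast
  qed
  show "\<Lambda> < omega2"
  proof (rule ccontr)
    assume "\<not> \<Lambda> < omega2"
    with le have \<Lambda>: "\<Lambda> = omega2" by simp
    have "\<phi> \<eta> 1 < omega1" if "\<eta> < omega2" for \<eta>
      using normal[of \<eta>] one_less_omega1 that \<Lambda> unfolding normal_fun_def
      by (auto simp: image_subset_iff)
    then obtain \<gamma> where "\<forall>\<beta><\<Lambda>. \<exists>\<eta>. \<beta> \<le> \<eta> \<and> \<eta> < \<Lambda> \<and> \<phi> \<eta> 1 = \<gamma>"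
      using omega2_pigeonhole[of "\<lambda>\<eta>. \<phi> \<eta> 1"] unfolding \<Lambda> by blast
    \<comment> \<open>Choosing an index above each \<beta> turns the cofinal fibre of \<gamma> into
      a sequence of length \<Lambda>, as \<open>p4\<close> demands.\<close>
    then obtain e where e: "\<And>\<beta>. \<beta> < \<Lambda> \<Longrightarrow> \<beta> \<le> e \<beta> \<and> e \<beta> < \<Lambda> \<and> \<phi> (e \<beta>) 1 = \<gamma>"
      by metis
    then have "(\<Inter>\<nu>\<in>{..<\<Lambda>}. V (\<phi> (e \<nu>))) = {}"
      using limit_SUP_eq[OF limit, of e] by (intro p4 limit) auto
    moreover have "\<gamma> \<in> V (\<phi> (e \<nu>))" if "\<nu> < \<Lambda>" for \<nu>
      unfolding V_def using e[OF that] one_less_omega1 by force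
    ultimately show False by blast
  qed
qed

end
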